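(* Let Algorithm 1 (described in the context) be run with parameters $\alpha=\frac{\sqrt2+1+\sqrt{2\sqrt2-1}}{2}$ and $\mu=\frac{1-\sqrt{8\sqrt2-11}}{2}\approx 0.22$. Then Algorithm 1 is $\frac{2}{1-\sqrt{8\sqrt2-11}}$-competitive, where $\frac{2}{1-\sqrt{8\sqrt2-11}}<4.55$, for task graphs following Amdahl's model. That is, for every number $P\ge 1$ of processors and every finite directed acyclic graph of moldable tasks all of which follow Amdahl's model, i.e. $t_j(p)=\frac{w_j}{p}+d_j$, the makespan $T$ produced by the algorithm satisfies $T\le \frac{2}{1-\sqrt{8\sqrt2-11}}\,T^{\mathrm{opt}}$, where $T^{\mathrm{opt}}$ is the optimal offline makespan.
   Context: Problem. A finite DAG $G=(V,E)$ of tasks is to be executed on $P$ identical processors. An edge $(i,j)$ means that task $j$ cannot start before task $i$ is completed. Tasks are moldable: when task $j$ starts, an integer number $p\in\{1,\dots,P\}$ of processors is chosen for it; it then runs without interruption on exactly $p$ processors for time $t_j(p)$. At any time at most $P$ processors are in use. Online setting: a task becomes available (and its parameters become known) only when all its predecessors are completed. The makespan is the completion time of the last task; $T^{\mathrm{opt}}$ is the minimum makespan over all feasible (offline) schedules. Amdahl's model: $t_j(p)=\frac{w_j}{p}+d_j$ with reals $w_j,d_j\ge0$, $w_j+d_j>0$. The area is $a_j(p)=p\,t_j(p)$. Put $p_j^{\max}=P$, $t_j^{\min}=t_j(P)$, $a_j^{\min}=a_j(1)$. Algorithm 1 with parameters $\alpha\ge1$, $\mu\in(0,1/2]$. Processor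 allocation: when task $j$ becomes available, (Step 1) choose an initial allocation $p_j\in\{1,\dots,p_j^{\max}\}$ minimizing $t_j(p)/t_j^{\min}$ subject to $a_j(p)/a_j^{\min}\le\alpha$; (Step 2) the final allocation is $p_j'=\min(p_j,\lceil\mu P\rceil)$. The task is then inserted into a waiting queue (in arbitrary order). List scheduling: at time $0$ and whenever a running task completes, after newly available tasks have been inserted, scan all tasks in the queue and start each task $j$ immediately on $p'_j$ processors if at least $p'_j$ processors are idle. *)

theory Defs
  imports Complex_Main
begin

text \<open>\<open>time G j p\<close> is the execution time of task \<open>j\<close> on \<open>p\<close> processors; only the values for
  \<open>1 \<le> p \<le> P\<close> are ever relevant.\<close>

record 'a task_graph =
  tasks :: "'a set"
  prec  :: "('a \<times> 'a) set"
  time  :: "'a \<Rightarrow> nat \<Rightarrow> real"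

definition finite_dag :: "'a task_graph \<Rightarrow> bool" where
  "finite_dag G \<longleftrightarrow> finite (tasks G) \<and> prec G \<subseteq> tasks G \<times> tasks G \<and> acyclic (prec G)"

definition amdahl :: "nat \<Rightarrow> 'a task_graph \<Rightarrow> bool" where
  "amdahl P G \<longleftrightarrow>
     (\<forall>j\<in>tasks G. \<exists>w d. 0 \<le> w \<and> 0 \<le> d \<and> 0 < w + d \<and>
        (\<forall>p\<in>{1..P}. time G j p = w / real p + d))"

definition area :: "'a task_graph \<Rightarrow> 'a \<Rightarrow> nat \<Rightarrow> real" where
  "area G j p = real p * time G j p"


text \<open>A schedule consists of start times \<open>s\<close> and processor allocations \<open>p\<close>. A task occupies its
  processors during the half-open interval from its start to its completion, so processors released
  at some instant can be reused at that instant.\<close>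

definition feasible :: "nat \<Rightarrow> 'a task_graph \<Rightarrow> ('a \<Rightarrow> real) \<Rightarrow> ('a \<Rightarrow> nat) \<Rightarrow> bool" where
  "feasible P G s p \<longleftrightarrow>
     (\<forall>j\<in>tasks G. 0 \<le> s j \<and> p j \<in> {1..P}) \<and>
     (\<forall>(i, j)\<in>prec G. s i + time G i (p i) \<le> s j) \<and>
     (\<forall>\<tau>. (\<Sum>j | j \<in> tasks G \<and> s j \<le> \<tau> \<and> \<tau> < s j + time G j (p j). p j) \<le> P)"

text \<open>The element 0 only matters for the graph without tasks.\<close>

definition makespan :: "'a task_graph \<Rightarrow> ('a \<Rightarrow> real) \<Rightarrow> ('a \<Rightarrow> nat) \<Rightarrow> real" where
  "makespan G s p = Max (insert 0 ((\<lambda>j. s j + time G j (p j)) ` tasks G))"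

definition opt_makespan :: "nat \<Rightarrow> 'a task_graph \<Rightarrow> real" where
  "opt_makespan P G = Inf {makespan G s p | s p. feasible P G s p}"


text \<open>In Amdahl's model the minimum execution time is \<open>time G j P\<close> and the minimum area is
  \<open>area G j 1\<close>.\<close>

definition initial_allocation :: "real \<Rightarrow> nat \<Rightarrow> 'a task_graph \<Rightarrow> 'a \<Rightarrow> nat \<Rightarrow> bool" where
  "initial_allocation \<alpha> P G j p \<longleftrightarrow>
     is_arg_min (\<lambda>q. time G j q / time G j P)
       (\<lambda>q. q \<in> {1..P} \<and> area G j q / area G j 1 \<le> \<alpha>) p"

definition final_allocation :: "real \<Rightarrow> real \<Rightarrow> nat \<Rightarrow> 'a task_graph \<Rightarrow> 'a \<Rightarrow> nat \<Rightarrow> bool" where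
  "final_allocation \<alpha> \<mu> P G j p' \<longleftrightarrow>
     (\<exists>p. initial_allocation \<alpha> P G j p \<and> p' = min p (nat \<lceil>\<mu> * real P\<rceil>))"


text \<open>List scheduling for given allocations \<open>p\<close>. The state after the events up to the current time
  is a pair of a map \<open>S\<close>, giving the start times of the tasks started so far, and the waiting
  queue.\<close>

definition completed :: "'a task_graph \<Rightarrow> ('a \<Rightarrow> nat) \<Rightarrow> real \<Rightarrow> ('a \<rightharpoonup> real) \<Rightarrow> 'a set" where
  "completed G p \<tau> S = {j. \<exists>s. S j = Some s \<and> s + time G j (p j) \<le> \<tau>}"

definition running :: "'a task_graph \<Rightarrow> ('a \<Rightarrow> nat) \<Rightarrow> real \<Rightarrow> ('a \<rightharpoonup> real) \<Rightarrow> 'a set" where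
  "running G p \<tau> S = dom S - completed G p \<tau> S"

definition idle :: "nat \<Rightarrow> 'a task_graph \<Rightarrow> ('a \<Rightarrow> nat) \<Rightarrow> real \<Rightarrow> ('a \<rightharpoonup> real) \<Rightarrow> nat" where
  "idle P G p \<tau> S = P - (\<Sum>j\<in>running G p \<tau> S. p j)"

definition available :: "'a task_graph \<Rightarrow> ('a \<Rightarrow> nat) \<Rightarrow> real \<Rightarrow> ('a \<rightharpoonup> real) \<Rightarrow> 'a set" where
  "available G p \<tau> S = {j \<in> tasks G. \<forall>i. (i, j) \<in> prec G \<longrightarrow> i \<in> completed G p \<tau> S}"

text \<open>\<open>scan p n q\<close> scans the queue \<open>q\<close> with \<open>n\<close> idle processors and returns the tasks that are
  started and the tasks that keep waiting.\<close>

fun scan :: "('a \<Rightarrow> nat) \<Rightarrow> nat \<Rightarrow> 'a list \<Rightarrow> 'a list \<times> 'a list" where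
  "scan p n [] = ([], [])"
| "scan p n (j # q) =
     (if p j \<le> n
      then let (started, waiting) = scan p (n - p j) q in (j # started, waiting)
      else let (started, waiting) = scan p n q in (started, j # waiting))"

text \<open>One event at time \<open>\<tau>\<close>: the newly available tasks are inserted at arbitrary positions and in
  arbitrary order into the queue, then the queue is scanned.\<close>

definition event ::
  "nat \<Rightarrow> 'a task_graph \<Rightarrow> ('a \<Rightarrow> nat) \<Rightarrow> real \<Rightarrow>
    ('a \<rightharpoonup> real) \<times> 'a list \<Rightarrow> ('a \<rightharpoonup> real) \<times> 'a list \<Rightarrow> bool" where
  "event P G p \<tau> = (\<lambda>(S, queue) (S', queue').
     \<exists>new q started.
       distinct new \<and> set new = available G p \<tau> S - dom S - set queue \<and>
       q \<in> shuffles queue new \<and>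
       scan p (idle P G p \<tau> S) q = (started, queue') \<and>
       S' = (\<lambda>j. if j \<in> set started then Some \<tau> else S j))"

text \<open>Tasks completing at the same time are handled in a single event.\<close>

inductive list_scheduling_state ::
  "nat \<Rightarrow> 'a task_graph \<Rightarrow> ('a \<Rightarrow> nat) \<Rightarrow> real \<Rightarrow> ('a \<rightharpoonup> real) \<times> 'a list \<Rightarrow> bool"
  for P G p where
  start: "event P G p 0 (Map.empty, []) (S, q) \<Longrightarrow> list_scheduling_state P G p 0 (S, q)"
| completion:
    "list_scheduling_state P G p \<tau> (S, q) \<Longrightarrow>
     running G p \<tau> S \<noteq> {} \<Longrightarrow>
     \<tau>' = Min ((\<lambda>j. the (S j) + time G j (p j)) ` running G p \<tau> S) \<Longrightarrow>
     event P G p \<tau>' (S, q) (S', q') \<Longrightarrow>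
     list_scheduling_state P G p \<tau>' (S', q')"

definition list_schedule ::
  "nat \<Rightarrow> 'a task_graph \<Rightarrow> ('a \<Rightarrow> nat) \<Rightarrow> ('a \<Rightarrow> real) \<Rightarrow> bool" where
  "list_schedule P G p s \<longleftrightarrow>
     (\<exists>\<tau> S q. list_scheduling_state P G p \<tau> (S, q) \<and> dom S = tasks G \<and>
        (\<forall>j\<in>tasks G. S j = Some (s j)))"

text \<open>The schedules that the algorithm can produce, for all choices left open by its description.\<close>

definition algorithm1_schedule ::
  "real \<Rightarrow> real \<Rightarrow> nat \<Rightarrow> 'a task_graph \<Rightarrow> ('a \<Rightarrow> real) \<Rightarrow> ('a \<Rightarrow> nat) \<Rightarrow> bool" where
  "algorithm1_schedule \<alpha> \<mu> P G s p \<longleftrightarrow>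
     (\<forall>j\<in>tasks G. final_allocation \<alpha> \<mu> P G j (p j)) \<and> list_schedule P G p s"


text \<open>The notions above are not vacuous: every Amdahl task graph has a feasible schedule, so that
  \<open>opt_makespan\<close> is the infimum of a nonempty set of nonnegative numbers, and the algorithm
  produces a schedule. The proof of the latter also shows that every run of list scheduling can be
  continued until all tasks are started.\<close>

lemma scan_props:
  assumes "scan p n q = (st, wt)"
  shows "set q = set st \<union> set wt \<and> (distinct q \<longrightarrow> distinct st \<and> distinct wt \<and> set st \<inter> set wt = {})
     \<and> (\<forall>j\<in>set wt. n < sum_list (map p st) + p j)"
  using assms
proof (induction p n q arbitrary: st wt rule: scan.induct)
  case (2 p n j q)
  show ?case
  proof (cases "p j \<le> n")
    case True
    obtain a b where ab: "scan p (n - p j) q = (a, b)" by fastforce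
    with 2(3) True have e: "st = j # a" "wt = b" by auto
    from 2(1)[OF True ab] show ?thesis unfolding e by auto
  next
    case False
    obtain a b where ab: "scan p n q = (a, b)" by fastforce
    with 2(3) False have e: "st = a" "wt = j # b" by auto
    from 2(2)[OF False ab] show ?thesis unfolding e using False by auto
  qed
qed auto

definition ls_invar where "ls_invar G p \<tau> S q \<longleftrightarrow> dom S \<subseteq> tasks G \<and> set q \<subseteq> tasks G \<and> distinct q \<and> set q \<inter> dom S = {}
   \<and> available G p \<tau> S \<subseteq> dom S \<union> set q \<and> (running G p \<tau> S = {} \<longrightarrow> q = [])"

lemma event_ex: assumes "finite (tasks G)" shows "\<exists>S' q'. event P G p \<tau> (S, q) (S', q')"
proof -
  have "finite (available G p \<tau> S - dom S - set q)"
    using assms by (auto simp: available_def)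
  from finite_distinct_list[OF this]
  obtain new where n: "distinct new" "set new = available G p \<tau> S - dom S - set q" by auto
  obtain st wt where sw: "scan p (idle P G p \<tau> S) (q @ new) = (st, wt)" by fastforce
  have "q @ new \<in> shuffles q new" by (induction q) (auto intro: Cons_in_shuffles_leftI)
  then have "event P G p \<tau> (S, q) (\<lambda>j. if j \<in> set st then Some \<tau> else S j, wt)"
    using n sw unfolding event_def split_conv by blast
  then show ?thesis by blast
qed

lemma event_inv:
  assumes ok: "\<forall>j\<in>tasks G. p j \<le> P \<and> 0 < time G j (p j)"
    and pre: "dom S \<subseteq> tasks G" "set q \<subseteq> tasks G" "distinct q" "set q \<inter> dom S = {}"
    and ev: "event P G p \<tau> (S, q) (S', q')"
  shows "ls_invar G p \<tau> S' q' \<and> completed G p \<tau> S' = completed G p \<tau> S"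
proof -
  from ev obtain new r st where n: "distinct new" "set new = available G p \<tau> S - dom S - set q"
    and r: "r \<in> shuffles q new" and sc: "scan p (idle P G p \<tau> S) r = (st, q')"
    and S': "S' = (\<lambda>j. if j \<in> set st then Some \<tau> else S j)"
    unfolding event_def by auto
  have sr: "set r = set q \<union> set new" using r by (simp add: set_shuffles)
  have dr: "distinct r" using distinct_disjoint_shuffles[OF pre(3) n(1) _ r] n(2) by blast
  note sp = scan_props[OF sc]
  have rV: "set r \<subseteq> tasks G" using sr n pre by (auto simp: available_def)
  have rd: "set r \<inter> dom S = {}" using sr n pre by auto
  have stV: "set st \<subseteq> tasks G" "set st \<inter> dom S = {}" using sp rV rd by auto
  have c: "completed G p \<tau> S' = completed G p \<tau> S"
    unfolding completed_def S' using stV ok by force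
  have d: "dom S' = dom S \<union> set st" unfolding S' by (auto split: if_splits)
  have av: "available G p \<tau> S' = available G p \<tau> S" unfolding available_def c ..
  have "q' = []" if "running G p \<tau> S' = {}"
  proof (rule ccontr)
    assume "q' \<noteq> []"
    then obtain j where j: "j \<in> set q'" by (cases q') auto
    have "completed G p \<tau> S \<subseteq> dom S" by (auto simp: completed_def)
    moreover have "(dom S \<union> set st) - completed G p \<tau> S = {}"
      using that by (simp only: running_def c d)
    ultimately have "set st \<subseteq> dom S" and rS: "running G p \<tau> S = {}"
      by (auto simp only: running_def)
    then have "st = []" using stV(2) by (metis inf.absorb1 set_empty)
    then have "P < p j" using sp j rS by (simp add: idle_def)
    moreover have "j \<in> tasks G" using j sp rV by blast
    ultimately show False using ok by (meson not_le)
  qed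
  moreover have "dom S' \<subseteq> tasks G" "set q' \<subseteq> tasks G" "distinct q'"
    using d pre(1) stV(1) sp rV dr by simp_all
  moreover have "set q' \<inter> dom S' = {}"
  proof -
    have "set q' \<inter> set st = {}" "set q' \<inter> dom S = {}" using sp dr rd by auto
    then show ?thesis by (simp add: d Int_Un_distrib)
  qed
  moreover have "available G p \<tau> S' \<subseteq> dom S' \<union> set q'"
  proof -
    have "available G p \<tau> S \<subseteq> dom S \<union> set r" using n(2) sr by auto
    then show ?thesis using sp by (simp add: d av Un_assoc)
  qed
  ultimately show ?thesis using c unfolding ls_invar_def by blast
qed

lemma run_terminates:
  assumes G: "finite_dag G" and ok: "\<forall>j\<in>tasks G. p j \<le> P \<and> 0 < time G j (p j)"
  shows "list_scheduling_state P G p \<tau> (S, q) \<Longrightarrow> ls_invar G p \<tau> S q \<Longrightarrow> \<exists>s. list_schedule P G p s"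
proof (induction "card (tasks G - completed G p \<tau> S)" arbitrary: \<tau> S q rule: less_induct)
  case less
  have fin: "finite (tasks G)" using G by (simp add: finite_dag_def)
  have cd: "completed G p \<tau> S \<subseteq> dom S" by (auto simp: completed_def)
  have dV: "dom S \<subseteq> tasks G" using less.prems by (simp add: ls_invar_def)
  show ?case
  proof (cases "running G p \<tau> S = {}")
    case True
    have q: "q = []" and av: "available G p \<tau> S \<subseteq> dom S" using True less.prems by (auto simp: ls_invar_def)
    have dc: "dom S = completed G p \<tau> S" using True cd by (auto simp: running_def)
    have "finite (prec G)" using G fin unfolding finite_dag_def by (meson finite_SigmaI finite_subset)
    then have wf: "wf (prec G)" using G finite_acyclic_wf unfolding finite_dag_def by blast
    have "dom S = tasks G"
    proof (rule ccontr)
      assume "dom S \<noteq> tasks G"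
      then obtain x where "x \<in> tasks G - dom S" using dV by auto
      from wfE_min[OF wf this] obtain j where j: "j \<in> tasks G - dom S"
        "\<And>i. (i, j) \<in> prec G \<Longrightarrow> i \<notin> tasks G - dom S" by blast
      then have "j \<in> available G p \<tau> S" using G dc unfolding available_def finite_dag_def by blast
      then show False using av j by auto
    qed
    then have "list_schedule P G p (\<lambda>j. the (S j))" unfolding list_schedule_def
      using less.prems by force
    then show ?thesis by blast
  next
    case False
    define \<tau>' where "\<tau>' = Min ((\<lambda>j. the (S j) + time G j (p j)) ` running G p \<tau> S)"
    obtain S' q' where ev: "event P G p \<tau>' (S, q) (S', q')" using event_ex[OF fin] by blast
    have reach: "list_scheduling_state P G p \<tau>' (S', q')"
      using list_scheduling_state.completion[OF less.prems(1) False \<tau>'_def ev] .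
    have I: "ls_invar G p \<tau>' S' q'" and c: "completed G p \<tau>' S' = completed G p \<tau>' S"
      using event_inv[OF ok _ _ _ _ ev] less.prems(2) unfolding ls_invar_def by blast+
    have fr: "finite (running G p \<tau> S)" using dV fin unfolding running_def
      by (meson Diff_subset finite_subset)
    then have "\<tau>' \<in> (\<lambda>j. the (S j) + time G j (p j)) ` running G p \<tau> S"
      unfolding \<tau>'_def using False by (intro Min_in) auto
    then obtain j where j: "j \<in> running G p \<tau> S" "\<tau>' = the (S j) + time G j (p j)" by auto
    then have "\<tau> < \<tau>'" "j \<in> completed G p \<tau>' S" "j \<notin> completed G p \<tau> S" "j \<in> tasks G"
      using dV unfolding running_def completed_def by (auto simp: dom_def)
    moreover have "completed G p \<tau> S \<subseteq> completed G p \<tau>' S"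
      using \<open>\<tau> < \<tau>'\<close> unfolding completed_def by force
    ultimately have "tasks G - completed G p \<tau>' S' \<subset> tasks G - completed G p \<tau> S"
      unfolding c by auto
    then have "card (tasks G - completed G p \<tau>' S') < card (tasks G - completed G p \<tau> S)"
      using fin by (intro psubset_card_mono) auto
    from less.hyps[OF this reach I] show ?thesis .
  qed
qed

lemma algorithm1_schedule_exists:
  assumes "1 \<le> P" "finite_dag G" "amdahl P G" "1 \<le> \<alpha>" "0 < \<mu>"
  shows "\<exists>s p. algorithm1_schedule \<alpha> \<mu> P G s p"
proof -
  have pos: "0 < time G j q" if j: "j \<in> tasks G" "q \<in> {1..P}" for j q
  proof -
    obtain w d where "0 \<le> w" "0 \<le> d" "0 < w + d" "time G j q = w / real q + d"
      using assms(3) j unfolding amdahl_def by metis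
    then show ?thesis using j
      by (cases "w = 0") (auto intro!: add_pos_nonneg divide_pos_pos)
  qed
  have "\<exists>p. initial_allocation \<alpha> P G j p \<and> p \<in> {1..P}" if j: "j \<in> tasks G" for j
  proof -
    let ?Q = "{q. q \<in> {1..P} \<and> area G j q / area G j 1 \<le> \<alpha>}"
    have "1 \<in> ?Q" using pos[OF j, of 1] assms by (auto simp: area_def)
    then have ne: "?Q \<noteq> {}" by blast
    have fin: "finite ?Q" by simp
    show ?thesis using ex_is_arg_min_if_finite[OF fin ne, of "\<lambda>q. time G j q / time G j P"]
      unfolding initial_allocation_def is_arg_min_def by auto
  qed
  then obtain p0 where p0: "\<And>j. j \<in> tasks G \<Longrightarrow> initial_allocation \<alpha> P G j (p0 j) \<and> p0 j \<in> {1..P}"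
    by metis
  define p where "p = (\<lambda>j. min (p0 j) (nat \<lceil>\<mu> * real P\<rceil>))"
  have "0 < \<mu> * real P" using assms by simp
  then have "1 \<le> nat \<lceil>\<mu> * real P\<rceil>" by linarith
  then have pP: "\<And>j. j \<in> tasks G \<Longrightarrow> p j \<in> {1..P}" using p0 unfolding p_def by force
  have ok: "\<forall>j\<in>tasks G. p j \<le> P \<and> 0 < time G j (p j)" using pP pos by auto
  obtain S q where ev: "event P G p 0 (Map.empty, []) (S, q)"
    using event_ex assms(2) unfolding finite_dag_def by blast
  have "ls_invar G p 0 S q" using event_inv[OF ok _ _ _ _ ev] by simp
  then obtain s where "list_schedule P G p s"
    using run_terminates[OF assms(2) ok list_scheduling_state.start[OF ev]] by blast
  moreover have "\<forall>j\<in>tasks G. final_allocation \<alpha> \<mu> P G j (p j)"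
    using p0 unfolding final_allocation_def p_def by blast
  ultimately have "algorithm1_schedule \<alpha> \<mu> P G s p"
    by (simp add: algorithm1_schedule_def)
  then show ?thesis by blast
qed

lemma topological_numbering:
  assumes "finite V" "E \<subseteq> V \<times> V" "acyclic E"
  shows "\<exists>f :: 'a \<Rightarrow> nat. inj_on f V \<and> (\<forall>(i, j)\<in>E. f i < f j)"
  using assms
proof (induction V arbitrary: E rule: finite_psubset_induct)
  case (psubset V)
  show ?case
  proof (cases "V = {}")
    case False
    then obtain x where "x \<in> V" by blast
    have "finite E" using psubset by (meson finite_SigmaI finite_subset)
    then have "wf (E\<inverse>)" using psubset.prems by (simp add: finite_acyclic_wf_converse)
    from wfE_min[OF this \<open>x \<in> V\<close>] obtain m where m: "m \<in> V" "\<And>y. (m, y) \<in> E \<Longrightarrow> y \<notin> V"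
      by (metis converse_iff)
    let ?E = "E \<inter> (V - {m}) \<times> (V - {m})"
    have "acyclic ?E" using psubset.prems(2) by (rule acyclic_subset) auto
    then obtain f :: "'a \<Rightarrow> nat" where f: "inj_on f (V - {m})" "\<forall>(i, j)\<in>?E. f i < f j"
      using psubset.IH[of "V - {m}" ?E] m by blast
    obtain b where b: "\<And>i. i \<in> V \<Longrightarrow> f i < b"
      using finite_nat_set_iff_bounded[of "f ` V"] psubset.hyps by auto
    have "inj_on (f(m := b)) V"
      unfolding inj_on_def
    proof (intro ballI impI)
      fix x y assume xy: "x \<in> V" "y \<in> V" "(f(m := b)) x = (f(m := b)) y"
      show "x = y"
        using xy f(1) b[of x] b[of y] by (auto simp: inj_on_def split: if_splits)
    qed
    moreover have "(f(m := b)) i < (f(m := b)) j" if e: "(i, j) \<in> E" for i j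
    proof -
      have "i \<in> V" "j \<in> V" "i \<noteq> m" using e psubset.prems(1) m by auto
      then show ?thesis using e f(2) b by auto
    qed
    ultimately show ?thesis by blast
  qed (use psubset.prems in auto)
qed

lemma feasible_exists:
  assumes P: "1 \<le> P" and G: "finite_dag G" "amdahl P G"
  shows "\<exists>s p. feasible P G s p"
proof -
  have t: "0 \<le> time G j 1" if "j \<in> tasks G" for j
    using assms that unfolding amdahl_def by fastforce
  have fin: "finite (tasks G)" and E: "prec G \<subseteq> tasks G \<times> tasks G"
    using G by (auto simp: finite_dag_def)
  obtain f :: "'a \<Rightarrow> nat" where f: "inj_on f (tasks G)" "\<forall>(i, j)\<in>prec G. f i < f j"
    using topological_numbering G unfolding finite_dag_def by metis
  define s where "s j = (\<Sum>i | i \<in> tasks G \<and> f i < f j. time G i 1)" for j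
  have step: "s i + time G i 1 \<le> s j" if ij: "i \<in> tasks G" "f i < f j" for i j
  proof -
    have "s i + time G i 1 = (\<Sum>k\<in>insert i {k \<in> tasks G. f k < f i}. time G k 1)"
      unfolding s_def using fin by simp
    also have "\<dots> \<le> s j" unfolding s_def using fin ij t by (intro sum_mono2) auto
    finally show ?thesis .
  qed
  have c: "card {j. j \<in> tasks G \<and> s j \<le> \<tau> \<and> \<tau> < s j + time G j 1} \<le> 1" (is "card ?A \<le> 1") for \<tau>
  proof -
    have "i = j" if "i \<in> ?A" "j \<in> ?A" for i j
    proof -
      have "\<not> f i < f j" "\<not> f j < f i" using step[of i j] step[of j i] that by auto
      then show ?thesis using f(1) that by (auto simp: inj_on_def)
    qed
    then show ?thesis using fin by (simp add: card_le_Suc0_iff_eq)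
  qed
  have "feasible P G s (\<lambda>_. 1)"
  proof -
    have "0 \<le> s j" for j unfolding s_def by (intro sum_nonneg) (use t in blast)
    moreover have "\<forall>(i, j)\<in>prec G. s i + time G i 1 \<le> s j" using step E f(2) by blast
    ultimately show ?thesis unfolding feasible_def using P c by (auto intro: order_trans)
  qed
  then show ?thesis by blast
qed

end

theory Submission
  imports Defs "HOL-Analysis.Analysis"
begin

text \<open>Let \<open>m = \<lceil>\<mu>P\<rceil>\<close>. Call an instant low if fewer than \<open>(1 - \<mu>)P\<close> processors are busy. At a low
  instant at least \<open>m\<close> processors are idle, so no available task waits, and going back along the
  predecessors that complete last yields a path of tasks one of which runs at every low instant. A
  task on this path either satisfies \<open>t\<^sub>j \<le> \<beta>t\<^sub>j\<^sup>m\<^sup>i\<^sup>n\<close> with \<open>\<beta> = \<alpha>/(\<alpha> - 1)\<close>, or it was cut down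
  to \<open>m\<close> processors. In the second case its execution time is at most \<open>w\<^sub>j/(\<mu>P) + d\<^sub>j\<close>, which may
  exceed \<open>\<beta>t\<^sub>j\<^sup>m\<^sup>i\<^sup>n\<close>, but the area it uses then does not count towards the other instants, whose total
  length is bounded by the remaining area. If \<open>WP\<close> is the work \<open>w\<close> done by cut-down path tasks at low
  instants and \<open>T\<^sup>o\<^sup>p\<^sup>t\<close> is the optimum, the two bounds add up to at most
  \<open>W/\<mu> + (\<beta> + \<alpha>/(1 - \<mu>))(T\<^sup>o\<^sup>p\<^sup>t - W)\<close>, and the parameters satisfy \<open>\<beta> + \<alpha>/(1 - \<mu>) = 1/\<mu>\<close>.\<close>

section \<open>List scheduling is greedy\<close>

text \<open>\<open>running\<close> is meaningful only at or after the last recorded start. The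
  condition \<open>a \<le> \<theta>\<close> makes this version valid at every earlier instant too,
  so that an invariant can speak about the past.\<close>

definition active :: "'a task_graph \<Rightarrow> ('a \<Rightarrow> nat) \<Rightarrow> ('a \<rightharpoonup> real) \<Rightarrow> real \<Rightarrow> 'a set" where
  "active G p S \<theta> = {j. \<exists>a. S j = Some a \<and> a \<le> \<theta> \<and> \<theta> < a + time G j (p j)}"

text \<open>\<open>scan\<close> only ever decreases the number of idle processors, so a task it
  passes over still does not fit once all starts are made. Truncated subtraction in
  \<open>idle\<close> is harmless: \<open>P < sum p (running G p \<tau> S)\<close> would make the
  second claim trivial.\<close>

lemma event_props:
  assumes ok: "\<forall>j\<in>tasks G. p j \<le> P \<and> 0 < time G j (p j)" and fin: "finite (tasks G)"
    and pre: "dom S \<subseteq> tasks G" "set q \<subseteq> tasks G" "distinct q" "set q \<inter> dom S = {}"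
    and ev: "event P G p \<tau> (S, q) (S', q')"
  shows "\<exists>D. D \<inter> dom S = {} \<and> S' = (\<lambda>j. if j \<in> D then Some \<tau> else S j)"
    and "\<forall>j\<in>set q'. P < sum p (running G p \<tau> S') + p j"
proof -
  from ev obtain new r st where n: "distinct new" "set new = available G p \<tau> S - dom S - set q"
    and r: "r \<in> shuffles q new" and sc: "scan p (idle P G p \<tau> S) r = (st, q')"
    and S': "S' = (\<lambda>j. if j \<in> set st then Some \<tau> else S j)"
    unfolding event_def by auto
  have sr: "set r = set q \<union> set new" using r by (simp add: set_shuffles)
  have dr: "distinct r" using distinct_disjoint_shuffles[OF pre(3) n(1) _ r] n(2) by blast
  note sp = scan_props[OF sc]
  have "set r \<subseteq> tasks G" "set r \<inter> dom S = {}" using sr n pre by (auto simp: available_def)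
  then have st: "set st \<subseteq> tasks G" "set st \<inter> dom S = {}" "distinct st" using sp dr by auto
  show "\<exists>D. D \<inter> dom S = {} \<and> S' = (\<lambda>j. if j \<in> D then Some \<tau> else S j)"
    using S' st(2) by blast
  have c: "completed G p \<tau> S' = completed G p \<tau> S"
    using event_inv[OF ok pre ev] by blast
  have "completed G p \<tau> S \<subseteq> dom S" by (auto simp: completed_def)
  moreover have "dom S' = dom S \<union> set st" unfolding S' by (auto split: if_splits)
  ultimately have run: "running G p \<tau> S' = running G p \<tau> S \<union> set st"
    and disj: "running G p \<tau> S \<inter> set st = {}"
    using st(2) unfolding running_def c by auto
  have "finite (running G p \<tau> S)"
    using pre(1) fin unfolding running_def by (meson Diff_subset finite_subset)
  then have "sum p (running G p \<tau> S') = sum p (running G p \<tau> S) + sum_list (map p st)"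
    unfolding run using disj st(3) by (simp add: sum.union_disjoint sum_list_distinct_conv_sum_set)
  then show "\<forall>j\<in>set q'. P < sum p (running G p \<tau> S') + p j"
    using sp unfolding idle_def by fastforce
qed

text \<open>Nothing starts or completes strictly between consecutive events, so what holds of the
  queue after one event persists up to the next. This carries the fourth conjunct, on the current
  queue, over to the last one, on every past instant \<open>\<theta>\<close>.\<close>

lemma state_greedy:
  assumes ok: "\<forall>j\<in>tasks G. p j \<le> P \<and> 0 < time G j (p j)"
    and G: "finite_dag G"
    and "list_scheduling_state P G p \<tau> (S, q)"
  shows "ls_invar G p \<tau> S q \<and> 0 \<le> \<tau> \<and> (\<forall>j a. S j = Some a \<longrightarrow> 0 \<le> a \<and> a \<le> \<tau>)
    \<and> (\<forall>j\<in>set q. P < sum p (running G p \<tau> S) + p j)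
    \<and> (\<forall>j\<in>tasks G. \<forall>\<theta>. 0 \<le> \<theta> \<longrightarrow> \<theta> < \<tau> \<longrightarrow> (\<forall>a. S j = Some a \<longrightarrow> \<theta> < a)
        \<longrightarrow> (\<forall>i. (i, j) \<in> prec G \<longrightarrow> (\<exists>b. S i = Some b \<and> b + time G i (p i) \<le> \<theta>))
        \<longrightarrow> P < sum p (active G p S \<theta>) + p j)"
  using assms(3)
proof (induction \<tau> "(S, q)" arbitrary: S q rule: list_scheduling_state.induct)
  case (start S q)
  have fin: "finite (tasks G)" using G by (simp add: finite_dag_def)
  have I: "ls_invar G p 0 S q"
    using event_inv[OF ok _ _ _ _ start] by simp
  have D: "\<exists>D. S = (\<lambda>j. if j \<in> D then Some 0 else None)"
    using event_props(1)[OF ok fin _ _ _ _ start] by auto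
  have Q: "\<forall>j\<in>set q. P < sum p (running G p 0 S) + p j"
    using event_props(2)[OF ok fin _ _ _ _ start] by simp
  show ?case using I D Q by (auto split: if_splits)
next
  case (completion \<tau> S q \<tau>' S' q')
  note IH = completion.hyps(2)
  have fin: "finite (tasks G)" using G by (simp add: finite_dag_def)
  have pre: "dom S \<subseteq> tasks G" "set q \<subseteq> tasks G" "distinct q" "set q \<inter> dom S = {}"
    and av: "available G p \<tau> S \<subseteq> dom S \<union> set q"
    using IH unfolding ls_invar_def by auto
  have past: "0 \<le> a \<and> a \<le> \<tau>" if "S j = Some a" for j a using IH that by blast
  have \<tau>0: "0 \<le> \<tau>" using IH by blast
  have I: "ls_invar G p \<tau>' S' q'"
    using event_inv[OF ok pre completion.hyps(5)] by blast
  have Q: "\<forall>j\<in>set q'. P < sum p (running G p \<tau>' S') + p j"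
    using event_props(2)[OF ok fin pre completion.hyps(5)] .
  obtain D where D: "D \<inter> dom S = {}" "S' = (\<lambda>j. if j \<in> D then Some \<tau>' else S j)"
    using event_props(1)[OF ok fin pre completion.hyps(5)] by blast
  have fr: "finite (running G p \<tau> S)"
    using pre(1) fin unfolding running_def by (meson Diff_subset finite_subset)
  have next_le: "\<tau>' \<le> a + time G j (p j)" if "S j = Some a" "\<tau> < a + time G j (p j)" for j a
  proof -
    have "j \<in> running G p \<tau> S" using that by (auto simp: running_def completed_def)
    then show ?thesis unfolding completion.hyps(4) using that fr
      by (intro Min_le) (auto simp: image_iff intro!: bexI[of _ j])
  qed
  have "\<tau>' \<in> (\<lambda>j. the (S j) + time G j (p j)) ` running G p \<tau> S"
    unfolding completion.hyps(4) using fr completion.hyps(3) by (intro Min_in) auto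
  then have lt: "\<tau> < \<tau>'" by (auto simp: running_def completed_def)
  have tpos: "0 < time G j (p j)" if "S' j = Some a" for j a
  proof -
    have "dom S' \<subseteq> tasks G" using I by (simp add: ls_invar_def)
    then show ?thesis using that ok by blast
  qed
  have act: "active G p S' \<theta> = active G p S \<theta>" if "\<theta> < \<tau>'" for \<theta>
    using that D unfolding active_def by (auto split: if_splits simp: dom_def)
  have run: "active G p S \<theta> = running G p \<tau> S" if "\<tau> \<le> \<theta>" "\<theta> < \<tau>'" for \<theta>
  proof
    show "active G p S \<theta> \<subseteq> running G p \<tau> S"
      using that by (auto simp: active_def running_def completed_def)
    show "running G p \<tau> S \<subseteq> active G p S \<theta>"
      using that past next_le by (fastforce simp: active_def running_def completed_def)
  qed
  have "P < sum p (active G p S' \<theta>) + p j"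
    if j: "j \<in> tasks G" and \<theta>: "0 \<le> \<theta>" "\<theta> < \<tau>'" and wait: "\<forall>a. S' j = Some a \<longrightarrow> \<theta> < a"
      and preds: "\<forall>i. (i, j) \<in> prec G \<longrightarrow> (\<exists>b. S' i = Some b \<and> b + time G i (p i) \<le> \<theta>)" for j \<theta>
  proof -
    have wait': "\<forall>a. S j = Some a \<longrightarrow> \<theta> < a"
      using wait D by (metis disjoint_iff domI)
    \<comment> \<open>Execution times are positive, so a predecessor completed by
      \<open>\<theta> < \<tau>'\<close> started before \<open>\<tau>'\<close> and is already
      recorded in \<open>S\<close>.\<close>
    have preds': "\<exists>b. S i = Some b \<and> b + time G i (p i) \<le> \<theta>" if ij: "(i, j) \<in> prec G" for i
    proof -
      obtain b where b: "S' i = Some b" "b + time G i (p i) \<le> \<theta>" using preds ij by blast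
      have "b < \<tau>'" using b tpos[OF b(1)] \<theta> by linarith
      then show ?thesis using b D by (auto split: if_splits)
    qed
    show ?thesis
    proof (cases "\<theta> < \<tau>")
      case True
      then show ?thesis using IH j \<theta> wait' preds' act by simp
    next
      case False
      \<comment> \<open>No completion lies strictly between \<open>\<tau>\<close> and
        \<open>\<tau>'\<close>, so predecessors completed by \<open>\<theta>\<close> were already
        completed at \<open>\<tau>\<close>.\<close>
      have "j \<in> available G p \<tau> S"
        unfolding available_def completed_def using j preds' next_le \<theta>(2) by fastforce
      moreover have "j \<notin> dom S" using wait' past False by force
      ultimately have "j \<in> set q" using av by blast
      then show ?thesis using IH act run False \<theta> by simp
    qed
  qed
  moreover have "\<forall>j a. S' j = Some a \<longrightarrow> 0 \<le> a \<and> a \<le> \<tau>'"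
    using D past lt \<tau>0 by (force split: if_splits)
  ultimately show ?case using I Q lt \<tau>0 by auto
qed

definition load :: "'a task_graph \<Rightarrow> ('a \<Rightarrow> real) \<Rightarrow> ('a \<Rightarrow> nat) \<Rightarrow> real \<Rightarrow> nat" where
  "load G s p \<theta> = (\<Sum>j | j \<in> tasks G \<and> s j \<le> \<theta> \<and> \<theta> < s j + time G j (p j). p j)"

text \<open>The invariant applied to the final state: the last event is no earlier than any start,
  so every instant before \<open>s j\<close> is covered.\<close>

lemma list_schedule_greedy:
  assumes ok: "\<forall>j\<in>tasks G. p j \<le> P \<and> 0 < time G j (p j)"
    and G: "finite_dag G" and ls: "list_schedule P G p s" and j: "j \<in> tasks G"
  shows "0 \<le> s j"
    and "0 \<le> \<theta> \<Longrightarrow> \<theta> < s j \<Longrightarrow> (\<And>i. (i, j) \<in> prec G \<Longrightarrow> s i + time G i (p i) \<le> \<theta>)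
      \<Longrightarrow> P < load G s p \<theta> + p j"
proof -
  from ls obtain \<tau> S q where st: "list_scheduling_state P G p \<tau> (S, q)" "dom S = tasks G"
    "\<forall>j\<in>tasks G. S j = Some (s j)" unfolding list_schedule_def by blast
  have sub: "prec G \<subseteq> tasks G \<times> tasks G" using G by (auto simp: finite_dag_def)
  note g = state_greedy[OF ok G st(1)]
  show "0 \<le> s j" using g st j by blast
  assume \<theta>: "0 \<le> \<theta>" "\<theta> < s j" and preds: "\<And>i. (i, j) \<in> prec G \<Longrightarrow> s i + time G i (p i) \<le> \<theta>"
  have "s j \<le> \<tau>" using g st j by blast
  moreover have "\<forall>i. (i, j) \<in> prec G \<longrightarrow> (\<exists>b. S i = Some b \<and> b + time G i (p i) \<le> \<theta>)"
    using preds sub st(3) by blast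
  moreover have "\<forall>a. S j = Some a \<longrightarrow> \<theta> < a" using \<theta> st(3) j by simp
  ultimately have "P < sum p (active G p S \<theta>) + p j"
    using g \<theta> j by (meson order_less_le_trans)
  moreover have "S i = Some a \<longleftrightarrow> i \<in> tasks G \<and> a = s i" for i a
    using st(2,3) by (metis domI option.inject)
  then have "active G p S \<theta> = {j. j \<in> tasks G \<and> s j \<le> \<theta> \<and> \<theta> < s j + time G j (p j)}"
    unfolding active_def by auto
  ultimately show "P < load G s p \<theta> + p j" by (simp add: load_def)
qed

text \<open>\<open>C\<close> is a path ending in \<open>j\<close>, built by going back along predecessors that complete last. The
  path property itself is replaced by its only consequence needed later, the lower bound for
  feasible schedules, which passes through the induction directly.\<close>

lemma critical_path:
  assumes ok: "\<forall>j\<in>tasks G. p j \<le> m \<and> m \<le> P \<and> 0 < time G j (p j)"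
    and G: "finite_dag G" and ls: "list_schedule P G p s" and "j \<in> tasks G"
  shows "\<exists>C\<subseteq>tasks G. (\<forall>\<theta>. 0 \<le> \<theta> \<longrightarrow> \<theta> < s j + time G j (p j) \<longrightarrow> load G s p \<theta> + m \<le> P
      \<longrightarrow> (\<exists>i\<in>C. s i \<le> \<theta> \<and> \<theta> < s i + time G i (p i)))
    \<and> (\<forall>s' p'. feasible P G s' p' \<longrightarrow> (\<forall>i\<in>tasks G. 0 \<le> time G i (p' i))
      \<longrightarrow> (\<Sum>i\<in>C. time G i (p' i)) \<le> s' j + time G j (p' j))"
proof -
  have fin: "finite (tasks G)" and sub: "prec G \<subseteq> tasks G \<times> tasks G"
    using G by (auto simp: finite_dag_def)
  have ok': "\<forall>j\<in>tasks G. p j \<le> P \<and> 0 < time G j (p j)" using ok by force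
  have "wf (prec G)"
    using G fin finite_acyclic_wf unfolding finite_dag_def by (meson finite_SigmaI finite_subset)
  then show ?thesis using \<open>j \<in> tasks G\<close>
  proof (induction j rule: wf_induct_rule)
    case (less j)
    \<comment> \<open>At such an instant at least \<open>m\<close> processors are idle, enough for
      \<open>j\<close>, so only an uncompleted predecessor can be delaying it.\<close>
    have greedy: "\<exists>i. (i, j) \<in> prec G \<and> \<theta> < s i + time G i (p i)"
      if "0 \<le> \<theta>" "\<theta> < s j" "load G s p \<theta> + m \<le> P" for \<theta>
    proof (rule ccontr)
      assume "\<not> ?thesis"
      then have "P < load G s p \<theta> + p j"
        using list_schedule_greedy(2)[OF ok' G ls less.prems that(1,2)] by force
      then show False using that(3) ok less.prems by fastforce
    qed
    show ?case
    proof (cases "\<exists>i. (i, j) \<in> prec G")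
      case False
      show ?thesis
      proof (intro exI[of _ "{j}"] conjI allI impI)
        fix \<theta> assume "0 \<le> \<theta>" "\<theta> < s j + time G j (p j)" "load G s p \<theta> + m \<le> P"
        then show "\<exists>i\<in>{j}. s i \<le> \<theta> \<and> \<theta> < s i + time G i (p i)"
          using greedy False by force
      qed (use less.prems in \<open>auto simp: feasible_def\<close>)
    next
      case True
      let ?f = "\<lambda>i. s i + time G i (p i)" and ?pred = "{i. (i, j) \<in> prec G}"
      have "finite ?pred" using sub fin by (auto intro: finite_subset)
      then have "Max (?f ` ?pred) \<in> ?f ` ?pred" "\<And>i. i \<in> ?pred \<Longrightarrow> ?f i \<le> Max (?f ` ?pred)"
        using True by (auto intro!: Max_in)
      then obtain k where k: "(k, j) \<in> prec G" and max: "\<And>i. (i, j) \<in> prec G \<Longrightarrow> ?f i \<le> ?f k"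
        by auto
      have kG: "k \<in> tasks G" using k sub by auto
      obtain C where C: "C \<subseteq> tasks G"
        and cover: "\<And>\<theta>. 0 \<le> \<theta> \<Longrightarrow> \<theta> < s k + time G k (p k) \<Longrightarrow> load G s p \<theta> + m \<le> P
          \<Longrightarrow> \<exists>i\<in>C. s i \<le> \<theta> \<and> \<theta> < s i + time G i (p i)"
        and path: "\<And>s' p'. feasible P G s' p' \<Longrightarrow> \<forall>i\<in>tasks G. 0 \<le> time G i (p' i)
          \<Longrightarrow> (\<Sum>i\<in>C. time G i (p' i)) \<le> s' k + time G k (p' k)"
        using less.IH[OF k kG] by blast
      show ?thesis
      proof (intro exI[of _ "insert j C"] conjI allI impI)
        fix \<theta> assume \<theta>: "0 \<le> \<theta>" "\<theta> < s j + time G j (p j)" "load G s p \<theta> + m \<le> P"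
        \<comment> \<open>A low-load instant before \<open>s j\<close> precedes the completion of
          some predecessor, hence that of \<open>k\<close>, which completes last, so
          \<open>C\<close> covers it; the later ones are covered by \<open>j\<close>.\<close>
        show "\<exists>i\<in>insert j C. s i \<le> \<theta> \<and> \<theta> < s i + time G i (p i)"
          using greedy[OF \<theta>(1) _ \<theta>(3)] max cover[OF \<theta>(1) _ \<theta>(3)] \<theta>(2) by fastforce
      next
        fix s' p' assume f: "feasible P G s' p'" and pos: "\<forall>i\<in>tasks G. 0 \<le> time G i (p' i)"
        \<comment> \<open>An inequality, because nothing records that \<open>j\<close> lies outside
          \<open>C\<close>.\<close>
        have "(\<Sum>i\<in>insert j C. time G i (p' i)) \<le> (\<Sum>i\<in>C. time G i (p' i)) + time G j (p' j)"
          using pos less.prems finite_subset[OF C fin] by (simp add: sum.insert_if)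
        also have "s' k + time G k (p' k) \<le> s' j" using f k unfolding feasible_def by blast
        then have "(\<Sum>i\<in>C. time G i (p' i)) + time G j (p' j) \<le> s' j + time G j (p' j)"
          using path[OF f pos] by linarith
        finally show "(\<Sum>i\<in>insert j C. time G i (p' i)) \<le> s' j + time G j (p' j)" .
      qed (use C less.prems in auto)
    qed
  qed
qed

section \<open>Areas\<close>

text \<open>Integrates a pointwise inequality between step functions. With processor counts as
  weights it turns bounds on the load at each instant into bounds on areas; a single term is written
  as a sum over the index set \<open>{()}\<close>.\<close>

lemma weighted_measure_mono:
  fixes X :: "'i \<Rightarrow> 'a::euclidean_space set" and Y :: "'j \<Rightarrow> 'a set"
  assumes "\<And>i. i \<in> I \<Longrightarrow> X i \<in> fmeasurable lborel"
    and "\<And>j. j \<in> J \<Longrightarrow> Y j \<in> fmeasurable lborel"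
    and "\<And>t. (\<Sum>i\<in>I. c i * indicator (X i) t) \<le> (\<Sum>j\<in>J. d j * indicator (Y j) t :: real)"
  shows "(\<Sum>i\<in>I. c i * measure lborel (X i)) \<le> (\<Sum>j\<in>J. d j * measure lborel (Y j))"
proof -
  have int: "integrable lborel (\<lambda>t. c * indicator A t :: real)"
    if "A \<in> fmeasurable lborel" for c and A :: "'a set"
    using that by (auto simp: fmeasurable_def)
  have "(\<Sum>i\<in>I. c i * measure lborel (X i)) = integral\<^sup>L lborel (\<lambda>t. \<Sum>i\<in>I. c i * indicator (X i) t)"
    using int assms(1) by (subst Bochner_Integration.integral_sum) auto
  also have "\<dots> \<le> integral\<^sup>L lborel (\<lambda>t. \<Sum>j\<in>J. d j * indicator (Y j) t)"
    by (intro integral_mono Bochner_Integration.integrable_sum int assms)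
  also have "\<dots> = (\<Sum>j\<in>J. d j * measure lborel (Y j))"
    using int assms(2) by (subst Bochner_Integration.integral_sum) auto
  finally show ?thesis .
qed

lemma fmeasurable_Ico [simp]: "{a..<b::real} \<in> fmeasurable lborel"
proof -
  have "cbox a b \<in> fmeasurable lborel" by (intro fmeasurableI emeasure_lborel_cbox_finite) simp
  then show ?thesis by (rule fmeasurableI2) auto
qed

lemma load_eq_sum:
  assumes "finite (tasks G)"
  shows "real (load G s p \<theta>)
    = (\<Sum>j\<in>tasks G. real (p j) * indicator {s j..<s j + time G j (p j)} \<theta>)"
proof -
  have "real (load G s p \<theta>)
      = (\<Sum>j\<in>tasks G. if s j \<le> \<theta> \<and> \<theta> < s j + time G j (p j) then real (p j) else 0)"
    unfolding load_def using assms by (auto simp: sum.inter_filter intro!: sum.cong)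
  also have "\<dots> = (\<Sum>j\<in>tasks G. real (p j) * indicator {s j..<s j + time G j (p j)} \<theta>)"
    by (intro sum.cong) auto
  finally show ?thesis .
qed

lemma makespan_ge:
  assumes "finite (tasks G)"
  shows "0 \<le> makespan G s p" and "j \<in> tasks G \<Longrightarrow> s j + time G j (p j) \<le> makespan G s p"
  using assms by (auto simp: makespan_def)

text \<open>At most \<open>P\<close> processors are busy at each instant before the makespan and
  none afterwards; integrate over time.\<close>

lemma feasible_area_le:
  assumes fin: "finite (tasks G)" and f: "feasible P G s p"
    and pos: "\<forall>j\<in>tasks G. 0 \<le> time G j (p j)"
  shows "(\<Sum>j\<in>tasks G. area G j (p j)) \<le> real P * makespan G s p"
proof -
  let ?M = "makespan G s p"
  let ?X = "\<lambda>j. {s j..<s j + time G j (p j)}"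
  have "(\<Sum>j\<in>tasks G. real (p j) * measure lborel (?X j))
      \<le> (\<Sum>j\<in>{()}. real P * measure lborel {0..<?M})"
  proof (rule weighted_measure_mono)
    fix \<theta>
    have in_span: "0 \<le> \<theta> \<and> \<theta> < ?M" if "j \<in> tasks G" "\<theta> \<in> ?X j" for j
      using that f makespan_ge(2)[OF fin that(1), of s p] unfolding feasible_def by force
    have "load G s p \<theta> \<le> P" using f by (simp add: feasible_def load_def)
    show "(\<Sum>j\<in>tasks G. real (p j) * indicator (?X j) \<theta>)
        \<le> (\<Sum>j\<in>{()}. real P * indicator {0..<?M} \<theta>)"
    proof (cases "0 \<le> \<theta> \<and> \<theta> < ?M")
      case True
      then show ?thesis using \<open>load G s p \<theta> \<le> P\<close> load_eq_sum[OF fin, of s p \<theta>] by simp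
    next
      case False
      then have "\<theta> \<notin> ?X j" if "j \<in> tasks G" for j using in_span that by blast
      then have "(\<Sum>j\<in>tasks G. real (p j) * indicator (?X j) \<theta>) = 0"
        by (intro sum.neutral ballI) (metis indicator_simps(2) mult_zero_right)
      then show ?thesis by simp
    qed
  qed auto
  then show ?thesis
    using pos makespan_ge(1)[OF fin] by (simp add: area_def cong: sum.cong)
qed

section \<open>Allocations in Amdahl's model\<close>

text \<open>On \<open>q\<close> processors the area is \<open>w + d * q\<close>, so cutting an
  allocation down keeps the area bound. If \<open>P\<close> processors are permitted, the initial
  allocation attains the minimum time; otherwise rounding down the tight allocation already brings
  the time below \<open>\<alpha> / (\<alpha> - 1) * d\<close>. The second alternative is the case of
  a cut.\<close>

lemma amdahl_final_allocation:
  assumes P: "1 \<le> P" and \<alpha>: "1 < \<alpha>" and \<mu>: "0 < \<mu>"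
    and wd: "0 \<le> w" "0 \<le> d" "0 < w + d" and t: "\<forall>p\<in>{1..P}. time G j p = w / real p + d"
    and fa: "final_allocation \<alpha> \<mu> P G j p'"
  shows "1 \<le> p'" "p' \<le> P" "p' \<le> nat \<lceil>\<mu> * real P\<rceil>" "area G j p' \<le> \<alpha> * (w + d)"
    "time G j p' \<le> \<alpha> / (\<alpha> - 1) * (w / real P + d)
      \<or> p' = nat \<lceil>\<mu> * real P\<rceil> \<and> time G j p' \<le> w / (\<mu> * real P) + d"
proof -
  let ?m = "nat \<lceil>\<mu> * real P\<rceil>" and ?\<beta> = "\<alpha> / (\<alpha> - 1)"
  have mP: "0 < \<mu> * real P" using \<mu> P by simp
  then have m: "1 \<le> ?m" "\<mu> * real P \<le> real ?m" by linarith+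
  from fa obtain p where ia: "initial_allocation \<alpha> P G j p" and p': "p' = min p ?m"
    unfolding final_allocation_def by blast
  have ar: "area G j q = w + d * real q" if "q \<in> {1..P}" for q
    using that t by (simp add: area_def field_simps)
  have a1: "area G j 1 = w + d" using ar[of 1] P by simp
  have p: "p \<in> {1..P}" "area G j p / area G j 1 \<le> \<alpha>"
    and opt: "\<And>q. q \<in> {1..P} \<Longrightarrow> area G j q / area G j 1 \<le> \<alpha> \<Longrightarrow>
      \<not> time G j q / time G j P < time G j p / time G j P"
    using ia unfolding initial_allocation_def is_arg_min_def by auto
  have tP: "time G j P = w / real P + d" using t P by simp
  have tP0: "0 < time G j P" unfolding tP using wd P
    by (cases "w = 0") (auto intro!: add_pos_nonneg divide_pos_pos)
  have opt': "time G j p \<le> time G j q" if "q \<in> {1..P}" "w + d * real q \<le> \<alpha> * (w + d)" for q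
    using opt[OF that(1)] that(2) tP0 wd ar[OF that(1)] a1 by (simp add: divide_simps not_less)
  show p'1: "1 \<le> p'" and p'P: "p' \<le> P" and "p' \<le> ?m" using p p' m by auto
  have "area G j p' \<le> area G j p"
    using ar[of p'] ar[OF p(1)] p'1 p'P wd p' by (auto intro: mult_left_mono)
  also have "\<dots> \<le> \<alpha> * (w + d)" using p(2) wd a1 by (simp add: divide_simps)
  finally show "area G j p' \<le> \<alpha> * (w + d)" .
  have \<beta>: "1 \<le> ?\<beta>" using \<alpha> by (simp add: field_simps)
  have "time G j p \<le> ?\<beta> * time G j P"
  proof (cases "w + d * real P \<le> \<alpha> * (w + d)")
    case True
    then have "time G j p \<le> 1 * time G j P" using opt'[of P] P by simp
    also have "\<dots> \<le> ?\<beta> * time G j P" using \<beta> tP0 by (intro mult_right_mono) auto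
    finally show ?thesis .
  next
    case False
    \<comment> \<open>For \<open>d = 0\<close> the area would be constant and \<open>P\<close>
      processors would be permitted.\<close>
    have "w \<le> \<alpha> * w" using \<alpha> wd mult_right_mono[of 1 \<alpha> w] by simp
    then have d: "0 < d" using False wd by (cases "d = 0") auto
    txt \<open>\<open>z\<close> is the real number of processors at which the area constraint is tight.\<close>
    define z where "z = (\<alpha> - 1) * (w / d) + \<alpha>"
    define r where "r = nat \<lfloor>z\<rfloor>"
    have zd: "d * z = \<alpha> * (w + d) - w" using d by (simp add: z_def field_simps)
    have "0 \<le> (\<alpha> - 1) * (w / d)" using \<alpha> wd d by simp
    then have "1 \<le> z" using \<alpha> unfolding z_def by linarith
    then have r: "1 \<le> r" "real r \<le> z" "z < real r + 1" unfolding r_def by linarith+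
    have "d * z < d * real P" using False zd by linarith
    then have "z < real P" using d by simp
    then have rP: "r \<in> {1..P}" using r by auto
    have "d * real r \<le> d * z" using r d by simp
    then have "w + d * real r \<le> \<alpha> * (w + d)" using zd by linarith
    from opt'[OF rP this] have "time G j p \<le> w / real r + d" using t rP by simp
    also have "w / real r \<le> d / (\<alpha> - 1)"
    proof -
      \<comment> \<open>Rounding \<open>z\<close> down costs less than one processor, that is, less
        than area \<open>d\<close>, which the summand \<open>\<alpha> * d\<close> of
        \<open>d * z\<close> absorbs.\<close>
      have "d * z \<le> d * (real r + 1)" using r d by simp
      moreover have "d \<le> \<alpha> * d" using d \<alpha> by simp
      ultimately have "(\<alpha> - 1) * w \<le> d * real r" using zd by (simp add: algebra_simps)
      then show ?thesis using \<alpha> r by (simp add: field_simps)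
    qed
    then have "w / real r + d \<le> ?\<beta> * d" using \<alpha> by (simp add: field_simps)
    also have "\<dots> \<le> ?\<beta> * time G j P" unfolding tP using \<beta> wd by (intro mult_left_mono) auto
    finally show ?thesis .
  qed
  moreover have "w / real ?m \<le> w / (\<mu> * real P)"
    using m mP wd by (intro divide_left_mono) auto
  ultimately show "time G j p' \<le> ?\<beta> * (w / real P + d)
      \<or> p' = ?m \<and> time G j p' \<le> w / (\<mu> * real P) + d"
    using t p'1 p'P tP p' by (auto simp: min_def split: if_splits)
qed

section \<open>The competitive ratio\<close>

text \<open>Comparing with an arbitrary feasible schedule lets the bound pass to the infimum
  \<open>opt_makespan\<close>. The specific parameters enter only through their ranges and
  \<open>ratio\<close>.\<close>

lemma greedy_ratio:
  fixes w d :: "'a \<Rightarrow> real"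
  assumes P: "1 \<le> P" and G: "finite_dag G" and \<alpha>: "1 < \<alpha>" and \<mu>: "0 < \<mu>" "\<mu> < 1"
    and ratio: "\<alpha> / (\<alpha> - 1) + \<alpha> / (1 - \<mu>) \<le> 1 / \<mu>"
    and wd: "\<And>j. j \<in> tasks G \<Longrightarrow> 0 \<le> w j \<and> 0 \<le> d j \<and> 0 < w j + d j"
    and t: "\<And>j q. j \<in> tasks G \<Longrightarrow> q \<in> {1..P} \<Longrightarrow> time G j q = w j / real q + d j"
    and alg: "algorithm1_schedule \<alpha> \<mu> P G s p" and f: "feasible P G s' p'"
  shows "\<mu> * makespan G s p \<le> makespan G s' p'"
proof -
  let ?T = "makespan G s p" and ?M = "makespan G s' p'"
  let ?m = "nat \<lceil>\<mu> * real P\<rceil>" and ?\<beta> = "\<alpha> / (\<alpha> - 1)"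
  have fin: "finite (tasks G)" using G by (simp add: finite_dag_def)
  have ls: "list_schedule P G p s" and fa: "\<And>j. j \<in> tasks G \<Longrightarrow> final_allocation \<alpha> \<mu> P G j (p j)"
    using alg by (auto simp: algorithm1_schedule_def)
  have alloc: "1 \<le> p j" "p j \<le> P" "p j \<le> ?m" "area G j (p j) \<le> \<alpha> * (w j + d j)"
    "time G j (p j) \<le> ?\<beta> * (w j / real P + d j)
      \<or> p j = ?m \<and> time G j (p j) \<le> w j / (\<mu> * real P) + d j" if "j \<in> tasks G" for j
  proof -
    have "0 \<le> w j" "0 \<le> d j" "0 < w j + d j" "\<forall>q\<in>{1..P}. time G j q = w j / real q + d j"
      using wd[OF that] t[OF that] by auto
    note a = amdahl_final_allocation[OF P \<alpha> \<mu>(1) this fa[OF that]]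
    show "1 \<le> p j" "p j \<le> P" "p j \<le> ?m" "area G j (p j) \<le> \<alpha> * (w j + d j)"
      "time G j (p j) \<le> ?\<beta> * (w j / real P + d j)
        \<or> p j = ?m \<and> time G j (p j) \<le> w j / (\<mu> * real P) + d j" by (fact a)+
  qed
  have "0 < \<mu> * real P" "\<mu> * real P \<le> 1 * real P"
    using \<mu> P by (auto intro!: mult_right_mono)
  then have m: "1 \<le> ?m" "\<mu> * real P \<le> real ?m" "?m \<le> P" by linarith+
  have tpos: "0 < time G j q" if "j \<in> tasks G" "q \<in> {1..P}" for j q
    using t[OF that] wd[OF that(1)] that(2)
    by (cases "w j = 0") (auto intro!: add_pos_nonneg divide_pos_pos)
  have tmin: "w j / real P + d j \<le> time G j q" if "j \<in> tasks G" "q \<in> {1..P}" for j q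
    using t[OF that] wd[OF that(1)] that(2) by (auto intro!: divide_left_mono)
  have p'P: "p' j \<in> {1..P}" if "j \<in> tasks G" for j using f that by (simp add: feasible_def)
  let ?t = "\<lambda>j. time G j (p j)"
  have tp: "0 < ?t j" if "j \<in> tasks G" for j using tpos[of j "p j"] alloc that by simp

  \<comment> \<open>The area \<open>w j + d j * q\<close> is smallest for \<open>q = 1\<close>, so
    the competitor, whose total area is at most \<open>real P * ?M\<close>, uses at least the sum of
    these minima.\<close>
  have area_opt: "(\<Sum>j\<in>tasks G. w j + d j) \<le> real P * ?M"
  proof -
    have "w j + d j \<le> area G j (p' j)" if "j \<in> tasks G" for j
    proof -
      have "d j * 1 \<le> d j * real (p' j)"
        using wd[OF that] p'P[OF that] by (intro mult_left_mono) auto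
      then show ?thesis using p'P[OF that] t[OF that p'P[OF that]] by (simp add: area_def field_simps)
    qed
    then have "(\<Sum>j\<in>tasks G. w j + d j) \<le> (\<Sum>j\<in>tasks G. area G j (p' j))" by (rule sum_mono)
    also have "\<dots> \<le> real P * ?M"
      using feasible_area_le[OF fin f] tpos p'P by (meson less_imp_le)
    finally show ?thesis .
  qed

  define Low where "Low = {\<theta> \<in> {0..<?T}. real (load G s p \<theta>) < (1 - \<mu>) * real P}"
  define High where "High = {0..<?T} - Low"
  let ?X = "\<lambda>j. {s j..<s j + ?t j}"
  have "(\<lambda>\<theta>. real (load G s p \<theta>)) \<in> borel_measurable borel"
    unfolding load_eq_sum[OF fin] by (intro borel_measurable_sum borel_measurable_times) auto
  then have "{\<theta> \<in> space borel. real (load G s p \<theta>) < (1 - \<mu>) * real P} \<in> sets borel"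
    by (intro borel_measurable_less) auto
  moreover have "Low = {0..<?T} \<inter> {\<theta> \<in> space borel. real (load G s p \<theta>) < (1 - \<mu>) * real P}"
    by (auto simp: Low_def)
  ultimately have "Low \<in> sets lborel" by simp
  moreover have "{0..<?T} \<in> fmeasurable lborel" by auto
  ultimately have fmL: "Low \<in> fmeasurable lborel"
    by (rule fmeasurableI2[rotated 2]) (auto simp: Low_def)
  have fmH: "High \<in> fmeasurable lborel"
    unfolding High_def using fmL by (intro fmeasurable.Diff) auto
  define x where "x j = measure lborel (Low \<inter> ?X j)" for j
  define y where "y j = measure lborel (High \<inter> ?X j)" for j
  have fmX: "Low \<inter> ?X j \<in> fmeasurable lborel" "High \<inter> ?X j \<in> fmeasurable lborel" for j
    using fmL fmH by (auto intro: fmeasurable_Int_fmeasurable)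
  have in_T: "?X j \<subseteq> {0..<?T}" if "j \<in> tasks G" for j
  proof -
    have "0 \<le> s j" using list_schedule_greedy(1)[OF _ G ls that] alloc tp by blast
    then show ?thesis using makespan_ge(2)[OF fin that, of s p] by auto
  qed
  have xy: "x j + y j = ?t j" if "j \<in> tasks G" for j
  proof -
    have disj: "(Low \<inter> ?X j) \<inter> (High \<inter> ?X j) = {}" by (auto simp: High_def)
    have "measure lborel (Low \<inter> ?X j \<union> High \<inter> ?X j) = x j + y j"
      using measure_Un3[OF fmX(1)[of j] fmX(2)[of j]] unfolding disj x_def y_def by simp
    also have "Low \<inter> ?X j \<union> High \<inter> ?X j = ?X j" using in_T[OF that] by (auto simp: High_def)
    finally have "measure lborel (?X j) = x j + y j" .
    then show ?thesis using tp[OF that] by simp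
  qed
  have LH: "?T = measure lborel Low + measure lborel High"
  proof -
    have "Low \<inter> High = {}" "Low \<union> High = {0..<?T}" by (auto simp: High_def Low_def)
    then show ?thesis using measure_Un3[OF fmL fmH] makespan_ge(1)[OF fin, of s p] by simp
  qed

  \<comment> \<open>More than \<open>\<mu> * real P\<close> processors are idle, and their number is
    an integer, hence at least the ceiling \<open>?m\<close>.\<close>
  have Low_idle: "0 \<le> \<theta> \<and> \<theta> < ?T \<and> load G s p \<theta> + ?m \<le> P" if "\<theta> \<in> Low" for \<theta>
  proof -
    have "\<mu> * real P < real P - real (load G s p \<theta>)" using that by (simp add: Low_def algebra_simps)
    then have "\<lceil>\<mu> * real P\<rceil> \<le> int P - int (load G s p \<theta>)" by (simp add: ceiling_le_iff)
    moreover have "1 \<le> \<lceil>\<mu> * real P\<rceil>" using m(1) by linarith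
    ultimately have "load G s p \<theta> + ?m \<le> P" by linarith
    then show ?thesis using that by (simp add: Low_def)
  qed
  obtain C where C: "C \<subseteq> tasks G" and cover: "\<And>\<theta>. \<theta> \<in> Low \<Longrightarrow> \<exists>i\<in>C. \<theta> \<in> ?X i"
    and path: "(\<Sum>i\<in>C. time G i (p' i)) \<le> ?M"
  proof (cases "tasks G = {}")
    case True
    \<comment> \<open>Without tasks the makespan is the default 0, so there are no low
      instants.\<close>
    then have "?T = 0" by (simp add: makespan_def)
    then show ?thesis using that[of "{}"] makespan_ge(1)[OF fin] by (simp add: Low_def)
  next
    case False
    have "?T \<in> insert 0 ((\<lambda>j. s j + ?t j) ` tasks G)"
      unfolding makespan_def using fin by (intro Max_in) auto
    moreover have "0 < ?T"
    proof -
      obtain j where "j \<in> tasks G" using False by blast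
      then show ?thesis using in_T[of j] tp[of j] by force
    qed
    \<comment> \<open>The path ending in a task that completes last covers the low instants all the
      way up to \<open>?T\<close>.\<close>
    ultimately obtain j where j: "j \<in> tasks G" "?T = s j + ?t j" by auto
    have "\<forall>j\<in>tasks G. p j \<le> ?m \<and> ?m \<le> P \<and> 0 < ?t j" using alloc m tp by blast
    from critical_path[OF this G ls j(1)] obtain C where "C \<subseteq> tasks G"
      "\<forall>\<theta>. 0 \<le> \<theta> \<longrightarrow> \<theta> < ?T \<longrightarrow> load G s p \<theta> + ?m \<le> P \<longrightarrow> (\<exists>i\<in>C. s i \<le> \<theta> \<and> \<theta> < s i + ?t i)"
      "(\<Sum>i\<in>C. time G i (p' i)) \<le> s' j + time G j (p' j)"
      using f tpos p'P j(2) by (metis less_imp_le)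
    then show ?thesis using that[of C] Low_idle makespan_ge(2)[OF fin j(1), of s' p'] by auto
  qed
  have finC: "finite C" using C fin by (rule finite_subset)

  txt \<open>The cut-down path tasks; \<open>x j / t j\<close> is the fraction of task \<open>j\<close> executed at low instants.\<close>
  define B where "B = {j \<in> C. \<not> ?t j \<le> ?\<beta> * (w j / real P + d j)}"
  have B: "B \<subseteq> C" "B \<subseteq> tasks G" "finite B" using C finC by (auto simp: B_def intro: finite_subset)
  \<comment> \<open>\<open>W\<close> and \<open>D\<close> are the parallel and the sequential part
    of the minimum times \<open>w j / real P + d j\<close> over \<open>B\<close>, weighted by these
    fractions. Cutting down inflates only \<open>W\<close>, by at most the factor
    \<open>1 / \<mu>\<close>.\<close>
  define W where "W = (\<Sum>j\<in>B. x j / ?t j * w j) / real P"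
  define D where "D = (\<Sum>j\<in>B. x j / ?t j * d j)"
  have x0: "0 \<le> x j" and y0: "0 \<le> y j" for j by (auto simp: x_def y_def)
  have frac: "0 \<le> x j / ?t j" "x j / ?t j \<le> 1" if "j \<in> tasks G" for j
    using xy[OF that] tp[OF that] x0[of j] y0[of j] by auto
  have \<beta>: "1 < ?\<beta>" using \<alpha> by (simp add: field_simps)

  have low: "measure lborel Low \<le> W / \<mu> + D + ?\<beta> * (?M - W - D)"
  proof -
    \<comment> \<open>Some path task runs at each low instant, so the low parts of the path tasks
      have at least the total length of \<open>Low\<close>.\<close>
    have "(\<Sum>j\<in>{()}. 1 * measure lborel Low) \<le> (\<Sum>j\<in>C. 1 * x j)"
      unfolding x_def
    proof (rule weighted_measure_mono)
      fix \<theta>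
      show "(\<Sum>j\<in>{()}. 1 * indicator Low \<theta>) \<le> (\<Sum>j\<in>C. 1 * indicator (Low \<inter> ?X j) \<theta> :: real)"
      proof (cases "\<theta> \<in> Low")
        case True
        then obtain i where i: "i \<in> C" "\<theta> \<in> ?X i" using cover by blast
        then have "1 \<le> (indicator (Low \<inter> ?X i) \<theta> :: real)" using True by simp
        also have "\<dots> \<le> (\<Sum>j\<in>C. indicator (Low \<inter> ?X j) \<theta>)"
          using i finC by (intro member_le_sum) auto
        finally show ?thesis using True by simp
      qed (auto intro: sum_nonneg)
    qed (use fmL fmX in auto)
    also have "(\<Sum>j\<in>C. 1 * x j) = (\<Sum>j\<in>B. x j) + (\<Sum>j\<in>C - B. x j)"
      using sum.subset_diff[OF B(1) finC, of x] by simp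
    also have "(\<Sum>j\<in>B. x j) \<le> W / \<mu> + D"
    proof -
      have "x j \<le> x j / ?t j * w j / (\<mu> * real P) + x j / ?t j * d j" if "j \<in> B" for j
      proof -
        have jG: "j \<in> tasks G" and "?t j \<le> w j / (\<mu> * real P) + d j"
          using that alloc(5)[of j] B(2) by (auto simp: B_def)
        from mult_left_mono[OF this(2) frac(1)[OF jG]]
        show ?thesis using tp[OF jG] by (simp add: ring_distribs)
      qed
      then have "(\<Sum>j\<in>B. x j) \<le> (\<Sum>j\<in>B. x j / ?t j * w j / (\<mu> * real P) + x j / ?t j * d j)"
        by (rule sum_mono)
      also have "\<dots> = W / \<mu> + D"
        by (simp add: W_def D_def sum.distrib sum_divide_distrib mult_ac)
      finally show ?thesis .
    qed
    also have "(\<Sum>j\<in>C - B. x j) \<le> ?\<beta> * (?M - W - D)"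
    proof -
      have "(\<Sum>j\<in>C - B. x j) \<le> (\<Sum>j\<in>C - B. ?\<beta> * (w j / real P + d j))"
      proof (rule sum_mono)
        fix j assume j: "j \<in> C - B"
        then show "x j \<le> ?\<beta> * (w j / real P + d j)"
          using xy[of j] y0[of j] C by (auto simp: B_def)
      qed
      also have "\<dots> = ?\<beta> * (\<Sum>j\<in>C - B. w j / real P + d j)" by (simp add: sum_distrib_left)
      also have "\<dots> \<le> ?\<beta> * (?M - W - D)"
      proof (rule mult_left_mono)
        \<comment> \<open>The fractions are at most 1, so \<open>W + D\<close> uses up no more than
          the share of \<open>B\<close> in the path bound \<open>?M\<close>; the rest is left for
          \<open>C - B\<close>.\<close>
        have "W + D = (\<Sum>j\<in>B. x j / ?t j * (w j / real P + d j))"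
          by (simp add: W_def D_def sum.distrib sum_divide_distrib ring_distribs)
        also have "\<dots> \<le> (\<Sum>j\<in>B. 1 * (w j / real P + d j))"
          using frac wd B(2) by (intro sum_mono mult_right_mono) auto
        finally have "W + D + (\<Sum>j\<in>C - B. w j / real P + d j) \<le> (\<Sum>j\<in>C. w j / real P + d j)"
          using sum.subset_diff[OF B(1) finC, of "\<lambda>j. w j / real P + d j"] by simp
        also have "\<dots> \<le> (\<Sum>j\<in>C. time G j (p' j))" using C tmin p'P by (intro sum_mono) auto
        also note path
        finally show "(\<Sum>j\<in>C - B. w j / real P + d j) \<le> ?M - W - D" by simp
      qed (use \<beta> in simp)
      finally show ?thesis .
    qed
    finally show ?thesis by simp
  qed

  have high: "(1 - \<mu>) * measure lborel High \<le> \<alpha> * (?M - W)"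
  proof -
    have "(\<Sum>j\<in>{()}. ((1 - \<mu>) * real P) * measure lborel High) \<le> (\<Sum>j\<in>tasks G. real (p j) * y j)"
      unfolding y_def
    proof (rule weighted_measure_mono)
      fix \<theta>
      show "(\<Sum>j\<in>{()}. ((1 - \<mu>) * real P) * indicator High \<theta>)
          \<le> (\<Sum>j\<in>tasks G. real (p j) * indicator (High \<inter> ?X j) \<theta>)"
        using load_eq_sum[OF fin, of s p \<theta>]
        by (cases "\<theta> \<in> High") (auto simp: High_def Low_def indicator_inter_arith)
    qed (use fmH fmX in auto)
    \<comment> \<open>What a task executes at low instants is missing from its area here. This
      saving is kept only for the work part of the tasks in \<open>B\<close>; the other savings are
      nonnegative and are dropped.\<close>
    also have "\<dots> \<le> (\<Sum>j\<in>tasks G. \<alpha> * (w j + d j) - (if j \<in> B then \<alpha> * (x j / ?t j * w j) else 0))"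
    proof (rule sum_mono)
      fix j assume j: "j \<in> tasks G"
      have "real (p j) * y j = (1 - x j / ?t j) * area G j (p j)"
      proof -
        have "(1 - x j / ?t j) * ?t j = y j"
          using xy[OF j] tp[OF j] by (simp add: left_diff_distrib)
        then show ?thesis by (simp only: area_def mult.left_commute)
      qed
      also have "\<dots> \<le> (1 - x j / ?t j) * (\<alpha> * (w j + d j))"
        using frac(2)[OF j] alloc(4)[OF j] by (intro mult_left_mono) auto
      also have "\<dots> = \<alpha> * (w j + d j) - \<alpha> * (x j / ?t j * w j) - \<alpha> * (x j / ?t j * d j)"
        by (simp add: algebra_simps)
      finally show "real (p j) * y j
          \<le> \<alpha> * (w j + d j) - (if j \<in> B then \<alpha> * (x j / ?t j * w j) else 0)"
        using \<alpha> wd[OF j] frac(1)[OF j] by (smt (verit) mult_nonneg_nonneg)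
    qed
    also have "\<dots> = \<alpha> * (\<Sum>j\<in>tasks G. w j + d j) - \<alpha> * (\<Sum>j\<in>B. x j / ?t j * w j)"
      using fin B(2) by (simp add: sum_subtractf sum_distrib_left sum.If_cases Int_absorb1)
    also have "\<dots> \<le> \<alpha> * (real P * ?M) - \<alpha> * (real P * W)"
      using area_opt \<alpha> P by (simp add: W_def)
    finally have "real P * ((1 - \<mu>) * measure lborel High) \<le> real P * (\<alpha> * (?M - W))"
      by (simp add: algebra_simps)
    then show ?thesis using P by simp
  qed

  have W: "0 \<le> D" "W \<le> ?M"
  proof -
    show "0 \<le> D" unfolding D_def using frac wd B(2) by (intro sum_nonneg mult_nonneg_nonneg) auto
    \<comment> \<open>\<open>high\<close> bounds a nonnegative quantity, which forces
      \<open>W \<le> ?M\<close>. Applying \<open>ratio\<close> multiplies it by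
      \<open>?M - W\<close>, hence the sign matters.\<close>
    have "0 \<le> \<alpha> * (?M - W)" using high \<mu> by (meson order_trans measure_nonneg mult_nonneg_nonneg diff_ge_0_iff_ge less_imp_le)
    then show "W \<le> ?M" using \<alpha> by (simp add: zero_le_mult_iff)
  qed
  have "measure lborel High \<le> \<alpha> / (1 - \<mu>) * (?M - W)" using high \<mu> by (simp add: field_simps)
  then have "?T \<le> W / \<mu> + D + ?\<beta> * (?M - W - D) + \<alpha> / (1 - \<mu>) * (?M - W)"
    using LH low by linarith
  \<comment> \<open>Now \<open>ratio\<close> bounds the coefficient of \<open>?M - W\<close> by
    \<open>1 / \<mu>\<close>, so that \<open>W\<close> cancels, while \<open>D\<close> only helps
    because \<open>?\<beta>\<close> exceeds 1.\<close>
  also have "\<dots> = W / \<mu> + (?\<beta> + \<alpha> / (1 - \<mu>)) * (?M - W) - (?\<beta> - 1) * D"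
    by (simp add: algebra_simps add_divide_distrib diff_divide_distrib)
  also have "\<dots> \<le> W / \<mu> + (1 / \<mu>) * (?M - W) - 0"
    using ratio W \<beta> by (intro diff_mono add_left_mono mult_right_mono) auto
  also have "\<dots> = ?M / \<mu>" by (simp add: diff_divide_distrib)
  finally show ?thesis using \<mu> by (simp add: field_simps)
qed

text \<open>Supplies the hypotheses of \<open>greedy_ratio\<close>; by the fourth claim
  \<open>ratio\<close> holds with equality.\<close>

lemma optimal_parameters:
  fixes \<alpha> \<mu> :: real
  assumes \<alpha>: "\<alpha> = (sqrt 2 + 1 + sqrt (2 * sqrt 2 - 1)) / 2"
    and \<mu>: "\<mu> = (1 - sqrt (8 * sqrt 2 - 11)) / 2"
  shows "1 < \<alpha>" "0 < \<mu>" "\<mu> < 1" "\<alpha> / (\<alpha> - 1) + \<alpha> / (1 - \<mu>) = 1 / \<mu>"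
    "2 / (1 - sqrt (8 * sqrt 2 - 11)) < 4.55"
proof -
  define r :: real where "r = sqrt 2"
  define u where "u = sqrt (2 * r - 1)"
  define v where "v = sqrt (8 * r - 11)"
  have r2: "r * r = 2" by (simp add: r_def)
  have r: "1.4 < r" "r < 1.41422" unfolding r_def
    by (rule real_less_rsqrt real_less_lsqrt; simp add: power2_eq_square)+
  have u2: "u * u = 2 * r - 1" and u: "1 < u" using r by (auto simp: u_def)
  have \<alpha>': "\<alpha> = (r + 1 + u) / 2" using \<alpha> by (simp add: r_def u_def)
  show \<alpha>1: "1 < \<alpha>" using r u \<alpha>' by simp
  txt \<open>Everything follows from \<open>\<alpha> + 1/\<alpha> = 1 + r\<close> and \<open>1 - \<mu> = \<alpha>/(1 + r)\<close>.\<close>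
  have quad: "\<alpha> * \<alpha> = (1 + r) * \<alpha> - 1"
    using u2 r2 unfolding \<alpha>' by (simp add: field_simps)
  \<comment> \<open>The radicand factors:
    \<open>8 * r - 11 = (2 * r - 1) * (r - 1)\<^sup>2\<close>.\<close>
  have v: "v = u * (r - 1)"
  proof -
    have "(u * (r - 1))\<^sup>2 = (u * u) * (r * r - 2 * r + 1)" by (simp add: power2_eq_square algebra_simps)
    also have "\<dots> = 8 * r - 11" using r2 unfolding u2 by (simp add: algebra_simps)
    finally show ?thesis unfolding v_def using r u by (intro real_sqrt_unique) auto
  qed
  have "1 - \<mu> = (1 + v) / 2" using \<mu> by (simp add: v_def r_def)
  then have "(1 + r) * (1 - \<mu>) = (1 + r + u * (r * r - 1)) / 2"
    unfolding v by (simp only:) (simp add: field_simps)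
  then have r\<mu>: "(1 + r) * (1 - \<mu>) = \<alpha>" unfolding \<alpha>' r2 by simp
  then have m1: "1 - \<mu> = \<alpha> / (1 + r)" using r by (simp add: eq_divide_eq mult.commute)
  \<comment> \<open>The constant lies between the root of \<open>8 * 1.41422 - 11\<close> and
    \<open>1 - 2 / 4.55\<close>; this narrow gap dictates the precision of the upper bound on
    \<open>r\<close>.\<close>
  have "v < 0.5604" unfolding v_def
    using r by (intro real_less_lsqrt) (auto simp: power2_eq_square)
  then have "2 / (1 - v) < 4.55" "0 < 1 - v" by (auto simp: divide_less_eq)
  then show "2 / (1 - sqrt (8 * sqrt 2 - 11)) < 4.55" "0 < \<mu>"
    unfolding \<mu> v_def r_def by simp_all
  have "0 < 1 - \<mu>" unfolding m1 using \<alpha>1 r by simp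
  then show "\<mu> < 1" by simp
  have inv: "\<mu> * (\<alpha> * (1 + r)) = 1"
  proof -
    have "\<mu> * (\<alpha> * (1 + r)) = (1 + r) * \<alpha> - \<alpha> * ((1 + r) * (1 - \<mu>))"
      by (simp add: algebra_simps)
    then show ?thesis unfolding r\<mu> quad by simp
  qed
  then have "1 / \<mu> = \<alpha> * (1 + r)" using \<open>0 < \<mu>\<close> by (simp add: field_simps)
  moreover have "\<alpha> / (1 - \<mu>) = 1 + r" using m1 \<alpha>1 r by simp
  \<comment> \<open>By \<open>quad\<close>,
    \<open>(\<alpha> - 1)\<^sup>2 = (r - 1) * \<alpha>\<close>, and
    \<open>(r + 1) * (r - 1) = 1\<close>.\<close>
  moreover have "\<alpha> = (\<alpha> - 1) * ((1 + r) * (\<alpha> - 1))"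
    using quad r2 by algebra
  then have "\<alpha> / (\<alpha> - 1) = (1 + r) * (\<alpha> - 1)" using \<alpha>1 by (simp add: field_simps)
  ultimately show "\<alpha> / (\<alpha> - 1) + \<alpha> / (1 - \<mu>) = 1 / \<mu>" by (simp add: algebra_simps)
qed

theorem theorem3:
  fixes \<alpha> \<mu> :: real
  assumes "\<alpha> = (sqrt 2 + 1 + sqrt (2 * sqrt 2 - 1)) / 2"
    and "\<mu> = (1 - sqrt (8 * sqrt 2 - 11)) / 2"
  shows "2 / (1 - sqrt (8 * sqrt 2 - 11)) < 4.55 \<and>
    (\<forall>(P :: nat) (G :: 'a task_graph) s p.
       1 \<le> P \<longrightarrow> finite_dag G \<longrightarrow> amdahl P G \<longrightarrow> algorithm1_schedule \<alpha> \<mu> P G s p \<longrightarrow>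
       makespan G s p \<le> 2 / (1 - sqrt (8 * sqrt 2 - 11)) * opt_makespan P G)"
proof (intro conjI allI impI)
  note par = optimal_parameters[OF assms]
  show "2 / (1 - sqrt (8 * sqrt 2 - 11)) < 4.55" by (fact par(5))
  fix P :: nat and G :: "'a task_graph" and s p
  assume P: "1 \<le> P" and G: "finite_dag G" "amdahl P G" and alg: "algorithm1_schedule \<alpha> \<mu> P G s p"
  obtain w d where wd: "\<And>j. j \<in> tasks G \<Longrightarrow> 0 \<le> w j \<and> 0 \<le> d j \<and> 0 < w j + d j"
    and t: "\<And>j q. j \<in> tasks G \<Longrightarrow> q \<in> {1..P} \<Longrightarrow> time G j q = w j / real q + d j"
    using G(2) unfolding amdahl_def by metis
  have "\<mu> * makespan G s p \<le> opt_makespan P G"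
    unfolding opt_makespan_def
  proof (rule cInf_greatest)
    show "{makespan G s p |s p. feasible P G s p} \<noteq> {}" using feasible_exists[OF P G] by blast
    show "\<mu> * makespan G s p \<le> M" if "M \<in> {makespan G s p |s p. feasible P G s p}" for M
      using that greedy_ratio[OF P G(1) par(1-3) eq_refl[OF par(4)] wd t alg] by blast
  qed
  moreover have "2 / (1 - sqrt (8 * sqrt 2 - 11)) = 1 / \<mu>"
    using assms(2) by (metis divide_divide_eq_right mult_1)
  ultimately show "makespan G s p \<le> 2 / (1 - sqrt (8 * sqrt 2 - 11)) * opt_makespan P G"
    using par(2) by (simp only: \<open>2 / _ = 1 / \<mu>\<close>) (simp add: field_simps)
qed

end
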